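(* Let $G$ be a connected graph. Then the following statements are equivalent: (A1) $G$ is $\{P_4, C_4, \text{paw}, \text{diamond}\}$-free; (A2) every graph search ordering of $G$ is a DFS ordering of $G$; (A3) every graph search ordering of $G$ is a BFS ordering of $G$; (A4) an ordering of $V(G)$ is a BFS ordering of $G$ if and only if it is a DFS ordering of $G$.
   Context: All graphs are finite and simple. For an ordering $\sigma$ of $V(G)$ write $x<_\sigma y$ if $x$ precedes $y$ in $\sigma$. A graph search (generic search) ordering of $G$ is an ordering of $V(G)$ such that every prefix induces a connected subgraph. An ordering $\sigma$ of $V(G)$ is a BFS ordering if whenever $a<_\sigma b<_\sigma c$, $ac\in E(G)$ and $ab\notin E(G)$, there is a vertex $d$ with $d<_\sigma a$ and $db\in E(G)$. It is a DFS ordering if whenever $a<_\sigma b<_\sigma c$, $ac\in E(G)$ and $ab\notin E(G)$, there is a vertex $d$ with $a<_\sigma d<_\sigma b$ and $db\in E(G)$. The paw is the graph consisting of a triangle plus one extra vertex adjacent to exactly one vertex of the triangle; the diamond is $K_4$ minus one edge. $G$ is $\mathcal{F}$-free if it contains no induced subgraph isomorphic to a member of $\mathcal{F}$. *)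

theory Defs
  imports "Graph_Theory.Graph_Theory"
begin

text \<open>
  Finite simple graphs are \<open>pair_graph\<close>s: finite, loop-free, symmetric sets of vertex pairs, so an
  edge \<open>xy\<close> is present as both \<open>(x, y)\<close> and \<open>(y, x)\<close>. An ordering of the vertices is a list that
  enumerates them without repetition.
\<close>

definition vertex_ordering :: "'a pair_pre_digraph \<Rightarrow> 'a list \<Rightarrow> bool" where
  "vertex_ordering G \<sigma> \<longleftrightarrow> distinct \<sigma> \<and> set \<sigma> = pverts G"

definition precedes :: "'a list \<Rightarrow> 'a \<Rightarrow> 'a \<Rightarrow> bool" where
  "precedes \<sigma> x y \<longleftrightarrow> (\<exists>i j. i < j \<and> j < length \<sigma> \<and> \<sigma> ! i = x \<and> \<sigma> ! j = y)"

text \<open>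
  The empty prefix is left out below because \<^const>\<open>connected\<close> requires a nonempty vertex set.
\<close>

definition search_ordering :: "'a pair_pre_digraph \<Rightarrow> 'a list \<Rightarrow> bool" where
  "search_ordering G \<sigma> \<longleftrightarrow> vertex_ordering G \<sigma> \<and>
     (\<forall>k. 1 \<le> k \<and> k \<le> length \<sigma> \<longrightarrow> connected (with_proj G \<restriction> set (take k \<sigma>)))"

definition bfs_ordering :: "'a pair_pre_digraph \<Rightarrow> 'a list \<Rightarrow> bool" where
  "bfs_ordering G \<sigma> \<longleftrightarrow> vertex_ordering G \<sigma> \<and>
     (\<forall>a b c. precedes \<sigma> a b \<and> precedes \<sigma> b c \<and> (a, c) \<in> parcs G \<and> (a, b) \<notin> parcs G \<longrightarrow>
        (\<exists>d. precedes \<sigma> d a \<and> (d, b) \<in> parcs G))"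

definition dfs_ordering :: "'a pair_pre_digraph \<Rightarrow> 'a list \<Rightarrow> bool" where
  "dfs_ordering G \<sigma> \<longleftrightarrow> vertex_ordering G \<sigma> \<and>
     (\<forall>a b c. precedes \<sigma> a b \<and> precedes \<sigma> b c \<and> (a, c) \<in> parcs G \<and> (a, b) \<notin> parcs G \<longrightarrow>
        (\<exists>d. precedes \<sigma> a d \<and> precedes \<sigma> d b \<and> (d, b) \<in> parcs G))"

definition graph_of_edges :: "'a set \<Rightarrow> 'a rel \<Rightarrow> 'a pair_pre_digraph" where
  "graph_of_edges V E = \<lparr> pverts = V, parcs = E \<union> E\<inverse> \<rparr>"

definition P4_graph :: "nat pair_pre_digraph" where
  "P4_graph = graph_of_edges {0, 1, 2, 3} {(0, 1), (1, 2), (2, 3)}"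

definition C4_graph :: "nat pair_pre_digraph" where
  "C4_graph = graph_of_edges {0, 1, 2, 3} {(0, 1), (1, 2), (2, 3), (3, 0)}"

definition paw_graph :: "nat pair_pre_digraph" where
  "paw_graph = graph_of_edges {0, 1, 2, 3} {(0, 1), (1, 2), (2, 0), (0, 3)}"

definition diamond_graph :: "nat pair_pre_digraph" where
  "diamond_graph = graph_of_edges {0, 1, 2, 3} {(0, 1), (0, 2), (0, 3), (1, 2), (1, 3)}"

definition free_of :: "'b pair_pre_digraph set \<Rightarrow> 'a pair_pre_digraph \<Rightarrow> bool" where
  "free_of \<F> G \<longleftrightarrow>
     \<not> (\<exists>F \<in> \<F>. \<exists>H. induced_subgraph H (with_proj G) \<and> digraph_iso H (with_proj F))"

end

theory Submission
  imports Defs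
begin

text \<open>
  All four forbidden graphs arise from one pattern: distinct vertices \<open>u, x, y, z\<close> with edges
  \<open>ux, uy, xz\<close> and non-edge \<open>xy\<close>; the status of \<open>uz\<close> and \<open>yz\<close> decides which of the four it is.

  If a search ordering has \<open>a < b < c\<close> with \<open>ac\<close> an edge and \<open>ab\<close> not, then an edge leaving the
  closed neighbourhood of \<open>a\<close> inside the connected prefix ending in \<open>b\<close> gives an induced path
  \<open>a u y\<close>, which together with \<open>c\<close> forms the pattern. So without the pattern the BFS and DFS
  conditions hold vacuously for every search ordering; conversely, on a connected graph BFS and DFS
  orderings are always search orderings.

  With the pattern, a BFS ordering that starts with \<open>u, x, y\<close> is not a DFS ordering, and a search
  ordering that starts with \<open>x, u, y\<close> is not a BFS ordering, in both cases because of
  \<open>x < y < z\<close>.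
\<close>

subsection \<open>Precedence in lists\<close>

lemma precedes_Nil [simp]: "\<not> precedes [] a b"
  by (simp add: precedes_def)

lemma precedes_Cons [simp]: "precedes (x # xs) a b \<longleftrightarrow> a = x \<and> b \<in> set xs \<or> precedes xs a b"
proof
  assume "precedes (x # xs) a b"
  then obtain i j where "i < j" "j < Suc (length xs)" "(x # xs) ! i = a" "(x # xs) ! j = b"
    by (auto simp: precedes_def)
  then show "a = x \<and> b \<in> set xs \<or> precedes xs a b"
    unfolding precedes_def by (cases i; cases j) auto
next
  assume "a = x \<and> b \<in> set xs \<or> precedes xs a b"
  then consider (head) j where "a = x" "j < length xs" "xs ! j = b"
    | (tail) i j where "i < j" "j < length xs" "xs ! i = a" "xs ! j = b"
    by (auto simp: precedes_def in_set_conv_nth)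
  then show "precedes (x # xs) a b"
  proof cases
    case head
    then show ?thesis unfolding precedes_def by (intro exI[of _ 0] exI[of _ "Suc j"]) simp
  next
    case tail
    then show ?thesis unfolding precedes_def by (intro exI[of _ "Suc i"] exI[of _ "Suc j"]) simp
  qed
qed

lemma precedes_append [simp]:
  "precedes (xs @ ys) a b \<longleftrightarrow> precedes xs a b \<or> precedes ys a b \<or> a \<in> set xs \<and> b \<in> set ys"
  by (induction xs) auto

lemma precedes_in_set:
  assumes "precedes xs a b"
  shows "a \<in> set xs" "b \<in> set xs"
  using assms by (induction xs) auto

lemma precedes_append_Cons_iff:
  assumes "distinct (xs @ b # ys)"
  shows "precedes (xs @ b # ys) a b \<longleftrightarrow> a \<in> set xs"
    and "precedes (xs @ b # ys) b c \<longleftrightarrow> c \<in> set ys"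
  using assms by (auto dest: precedes_in_set)

lemma precedes_trans:
  assumes "distinct xs" "precedes xs a b" "precedes xs b c"
  shows "precedes xs a c"
  using assms by (induction xs) (auto dest: precedes_in_set)

subsection \<open>Induced embeddings\<close>

definition induced_embedding ::
  "'b pair_pre_digraph \<Rightarrow> 'a pair_pre_digraph \<Rightarrow> ('b \<Rightarrow> 'a) \<Rightarrow> bool" where
  "induced_embedding F G g \<longleftrightarrow> inj_on g (pverts F) \<and> g ` pverts F \<subseteq> pverts G \<and>
     (\<forall>a\<in>pverts F. \<forall>b\<in>pverts F. (g a, g b) \<in> parcs G \<longleftrightarrow> (a, b) \<in> parcs F)"

lemma (in pair_wf_digraph) parcs_subset: "parcs G \<subseteq> pverts G \<times> pverts G"
  using wellformed' by auto

lemma (in pair_wf_digraph) induced_embedding_iff_parcs_image: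
  "induced_embedding G K g \<longleftrightarrow> inj_on g (pverts G) \<and> g ` pverts G \<subseteq> pverts K \<and>
     parcs K \<inter> g ` pverts G \<times> g ` pverts G = map_prod g g ` parcs G"
proof (cases "inj_on g (pverts G)")
  case inj: True
  have image_iff: "(g a, g b) \<in> map_prod g g ` parcs G \<longleftrightarrow> (a, b) \<in> parcs G"
    if "a \<in> pverts G" "b \<in> pverts G" for a b
    using inj_on_image_mem_iff[OF map_prod_inj_on[OF inj inj], of "(a, b)" "parcs G"] that
      parcs_subset by simp
  have "map_prod g g ` parcs G \<subseteq> g ` pverts G \<times> g ` pverts G" using parcs_subset by auto
  then have "parcs K \<inter> g ` pverts G \<times> g ` pverts G = map_prod g g ` parcs G \<longleftrightarrow>
      (\<forall>e \<in> g ` pverts G \<times> g ` pverts G. e \<in> parcs K \<longleftrightarrow> e \<in> map_prod g g ` parcs G)"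
    by blast
  also have "\<dots> \<longleftrightarrow> (\<forall>a\<in>pverts G. \<forall>b\<in>pverts G. (g a, g b) \<in> parcs K \<longleftrightarrow> (a, b) \<in> parcs G)"
    by (simp add: image_iff)
  finally show ?thesis by (simp add: induced_embedding_def)
qed (simp add: induced_embedding_def)

lemma arcs_ends_induced_subgraph:
  assumes "induced_subgraph H (with_proj G)"
  shows "arcs_ends H = parcs G \<inter> verts H \<times> verts H"
  using assms
  by (auto simp: induced_subgraph_def subgraph_def compatible_def arcs_ends_conv image_iff)

lemma (in pair_wf_digraph) digraph_iso_imp_induced_embedding:
  assumes "induced_subgraph H (with_proj K)" "digraph_iso (with_proj G) H"
  shows "\<exists>g. induced_embedding G K g"
proof -
  obtain f where f: "digraph_isomorphism f" and H: "H = app_iso f (with_proj G)"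
    using assms(2) by (auto simp: digraph_iso_def)
  define g where "g = iso_verts f"
  have "inj_on g (pverts G)"
    using digraph_isomorphism_inj_on_verts[OF f] by (simp add: g_def)
  moreover have "g ` pverts G \<subseteq> pverts K"
    using subgraph_imp_subverts[OF induced_imp_subgraph[OF assms(1)]] by (simp add: H g_def)
  moreover have "parcs K \<inter> g ` pverts G \<times> g ` pverts G = map_prod g g ` parcs G"
    using arcs_ends_app_iso_eq[OF f] arcs_ends_induced_subgraph[OF assms(1)]
    by (simp add: H g_def map_prod_def)
  ultimately show ?thesis unfolding induced_embedding_iff_parcs_image by blast
qed

lemma (in pair_wf_digraph) induced_embedding_imp_digraph_iso:
  assumes "induced_embedding G K g"
  shows "digraph_iso (with_proj G) (with_proj K \<restriction> g ` pverts G)"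
proof -
  define f where
    "f = \<lparr>iso_verts = g, iso_arcs = map_prod g g, iso_head = snd, iso_tail = fst\<rparr>"
  have inj: "inj_on g (pverts G)" using assms by (simp add: induced_embedding_def)
  then have "inj_on (map_prod g g) (parcs G)"
    using map_prod_inj_on[OF inj inj] parcs_subset by (blast intro: inj_on_subset)
  then have "digraph_isomorphism f"
    using inj wf_digraph by (simp add: digraph_isomorphism_def f_def)
  moreover have "with_proj K \<restriction> g ` pverts G = app_iso f (with_proj G)"
    using assms unfolding induced_embedding_iff_parcs_image
    by (simp add: induce_subgraph_def app_iso_def f_def Int_def mem_Times_iff)
  ultimately show ?thesis unfolding digraph_iso_def by blast
qed

lemma ex_induced_copy_iff:
  assumes "pair_wf_digraph F" "pair_wf_digraph G"
  shows "(\<exists>H. induced_subgraph H (with_proj G) \<and> digraph_iso H (with_proj F)) \<longleftrightarrow>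
    (\<exists>g. induced_embedding F G g)"
proof -
  interpret F: pair_wf_digraph F by fact
  interpret G: pair_wf_digraph G by fact
  show ?thesis
  proof
    assume "\<exists>H. induced_subgraph H (with_proj G) \<and> digraph_iso H (with_proj F)"
    then show "\<exists>g. induced_embedding F G g"
      by (blast intro: F.digraph_iso_imp_induced_embedding digraph_iso_swap wf_digraphI_induced)
  next
    assume "\<exists>g. induced_embedding F G g"
    then obtain g where g: "induced_embedding F G g" by blast
    then have "induced_subgraph (with_proj G \<restriction> g ` pverts F) (with_proj G)"
      by (intro G.induced_induce) (simp add: induced_embedding_def)
    moreover have "digraph_iso (with_proj G \<restriction> g ` pverts F) (with_proj F)"
      using F.induced_embedding_imp_digraph_iso[OF g] by (rule digraph_iso_swap[OF F.wf_digraph])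
    ultimately show "\<exists>H. induced_subgraph H (with_proj G) \<and> digraph_iso H (with_proj F)" by blast
  qed
qed

lemma free_of_iff:
  assumes "pair_wf_digraph G" "\<And>F. F \<in> \<F> \<Longrightarrow> pair_wf_digraph F"
  shows "free_of \<F> G \<longleftrightarrow> (\<forall>F\<in>\<F>. \<nexists>g. induced_embedding F G g)"
  using ex_induced_copy_iff[OF assms(2) assms(1)] by (auto simp: free_of_def)

lemma induced_embeddingI_less:
  fixes F :: "'b::linorder pair_pre_digraph"
  assumes "pair_bidirected_digraph F" "pair_bidirected_digraph G"
    and "inj_on g (pverts F)" "g ` pverts F \<subseteq> pverts G"
    and less: "\<And>a b. a \<in> pverts F \<Longrightarrow> b \<in> pverts F \<Longrightarrow> a < b \<Longrightarrow>
      (g a, g b) \<in> parcs G \<longleftrightarrow> (a, b) \<in> parcs F"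
  shows "induced_embedding F G g"
proof -
  interpret F: pair_bidirected_digraph F by fact
  interpret G: pair_bidirected_digraph G by fact
  have "(g a, g b) \<in> parcs G \<longleftrightarrow> (a, b) \<in> parcs F" if "a \<in> pverts F" "b \<in> pverts F" for a b
  proof (cases a b rule: linorder_cases)
    case equal
    then show ?thesis using F.pair_no_loops G.pair_no_loops by fastforce
  next
    case greater
    then show ?thesis using less[of b a] that F.arcs_symmetric G.arcs_symmetric by blast
  qed (use less that in blast)
  then show ?thesis using assms(3,4) by (simp add: induced_embedding_def)
qed

lemma induced_embedding_nthI:
  assumes "pair_bidirected_digraph F" "pair_bidirected_digraph G" "pverts F = {..<length vs}"
    and "distinct vs" "set vs \<subseteq> pverts G"
    and "\<And>i j. i < j \<Longrightarrow> j < length vs \<Longrightarrow> (vs ! i, vs ! j) \<in> parcs G \<longleftrightarrow> (i, j) \<in> parcs F"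
  shows "induced_embedding F G ((!) vs)"
  using assms by (intro induced_embeddingI_less) (auto simp: inj_on_nth)

lemma (in pair_sym_digraph) arcs_commute: "(a, b) \<in> parcs G \<longleftrightarrow> (b, a) \<in> parcs G"
  using arcs_symmetric by blast

lemma pair_bidirected_digraph_graph_of_edges:
  assumes "E \<subseteq> V \<times> V" "irrefl E"
  shows "pair_bidirected_digraph (graph_of_edges V E)"
proof unfold_locales
  show "symmetric (with_proj (graph_of_edges V E))"
    by (auto simp: graph_of_edges_def symmetric_def intro!: symI)
qed (use assms in \<open>auto simp: graph_of_edges_def irrefl_def\<close>)

subsection \<open>The pattern common to the forbidden graphs\<close>

abbreviation (input) forbidden_graphs :: "nat pair_pre_digraph set" where
  "forbidden_graphs \<equiv> {P4_graph, C4_graph, paw_graph, diamond_graph}"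

lemmas forbidden_graph_defs = P4_graph_def C4_graph_def paw_graph_def diamond_graph_def

lemma pair_bidirected_digraph_forbidden_graph:
  assumes "F \<in> forbidden_graphs"
  shows "pair_bidirected_digraph F"
  using assms unfolding forbidden_graph_defs
  by (auto intro!: pair_bidirected_digraph_graph_of_edges simp: irrefl_def)

definition extended_cherry :: "'a pair_pre_digraph \<Rightarrow> 'a \<Rightarrow> 'a \<Rightarrow> 'a \<Rightarrow> 'a \<Rightarrow> bool" where
  "extended_cherry G u x y z \<longleftrightarrow> distinct [u, x, y, z] \<and>
     (u, x) \<in> parcs G \<and> (u, y) \<in> parcs G \<and> (x, z) \<in> parcs G \<and> (x, y) \<notin> parcs G"

lemma (in pair_wf_digraph) extended_cherry_in_verts:
  assumes "extended_cherry G u x y z"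
  shows "{u, x, y, z} \<subseteq> pverts G"
  using assms wellformed' by (auto simp: extended_cherry_def)

lemma (in pair_wf_digraph) extended_cherry_induced_embedding:
  assumes "extended_cherry G u x y z" "induced_embedding G H g"
  shows "extended_cherry H (g u) (g x) (g y) (g z)"
  using assms extended_cherry_in_verts[OF assms(1)]
  by (auto simp: extended_cherry_def induced_embedding_def dest: inj_onD)

lemma ex_extended_cherry_forbidden_graph:
  assumes "F \<in> forbidden_graphs"
  shows "\<exists>u x y z. extended_cherry F u x y z"
proof -
  have "extended_cherry P4_graph 1 2 0 3" "extended_cherry C4_graph 1 2 0 3"
    "extended_cherry paw_graph 0 1 3 2" "extended_cherry diamond_graph 0 2 3 1"
    by (auto simp: extended_cherry_def forbidden_graph_defs graph_of_edges_def)
  with assms show ?thesis by blast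
qed

lemma (in pair_graph) extended_cherry_imp_induced_forbidden_graph:
  assumes "extended_cherry G u x y z"
  shows "\<exists>F\<in>forbidden_graphs. \<exists>g. induced_embedding F G g"
proof -
  note embeddingI = induced_embedding_nthI[OF pair_bidirected_digraph_forbidden_graph
      pair_bidirected_digraph_axioms]
  note simps = extended_cherry_def forbidden_graph_defs graph_of_edges_def
    less_Suc_eq numeral_eq_Suc arcs_commute
  have verts: "{u, x, y, z} \<subseteq> pverts G" using assms by (rule extended_cherry_in_verts)
  consider (P4) "(u, z) \<notin> parcs G" "(y, z) \<notin> parcs G"
    | (C4) "(u, z) \<notin> parcs G" "(y, z) \<in> parcs G"
    | (paw) "(u, z) \<in> parcs G" "(y, z) \<notin> parcs G"
    | (diamond) "(u, z) \<in> parcs G" "(y, z) \<in> parcs G" by blast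
  then show ?thesis
  proof cases
    case P4
    have "induced_embedding P4_graph G ((!) [y, u, x, z])"
      using P4 assms verts by (intro embeddingI) (auto simp: simps)
    then show ?thesis by blast
  next
    case C4
    have "induced_embedding C4_graph G ((!) [y, u, x, z])"
      using C4 assms verts by (intro embeddingI) (auto simp: simps)
    then show ?thesis by blast
  next
    case paw
    have "induced_embedding paw_graph G ((!) [u, x, z, y])"
      using paw assms verts by (intro embeddingI) (auto simp: simps)
    then show ?thesis by blast
  next
    case diamond
    have "induced_embedding diamond_graph G ((!) [u, z, x, y])"
      using diamond assms verts by (intro embeddingI) (auto simp: simps)
    then show ?thesis by blast
  qed
qed

lemma (in pair_graph) free_of_forbidden_graphs_iff:
  "free_of forbidden_graphs G \<longleftrightarrow> (\<nexists>u x y z. extended_cherry G u x y z)"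
proof -
  have wf: "pair_wf_digraph F" if "F \<in> forbidden_graphs" for F
    using pair_bidirected_digraph_forbidden_graph[OF that]
    by (simp add: pair_bidirected_digraph_def pair_sym_digraph_def)
  have "free_of forbidden_graphs G \<longleftrightarrow> (\<forall>F\<in>forbidden_graphs. \<nexists>g. induced_embedding F G g)"
    by (intro free_of_iff pair_wf_digraph wf)
  also have "\<dots> \<longleftrightarrow> \<not> (\<exists>F\<in>forbidden_graphs. \<exists>g. induced_embedding F G g)" by blast
  also have "(\<exists>F\<in>forbidden_graphs. \<exists>g. induced_embedding F G g) \<longleftrightarrow>
    (\<exists>u x y z. extended_cherry G u x y z)"
  proof
    assume "\<exists>F\<in>forbidden_graphs. \<exists>g. induced_embedding F G g"
    then obtain F g where F: "F \<in> forbidden_graphs" and g: "induced_embedding F G g" by blast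
    obtain u x y z where "extended_cherry F u x y z"
      using ex_extended_cherry_forbidden_graph[OF F] by blast
    from pair_wf_digraph.extended_cherry_induced_embedding[OF wf[OF F] this g]
    show "\<exists>u x y z. extended_cherry G u x y z" by blast
  next
    assume "\<exists>u x y z. extended_cherry G u x y z"
    then obtain u x y z where "extended_cherry G u x y z" by blast
    then show "\<exists>F\<in>forbidden_graphs. \<exists>g. induced_embedding F G g"
      by (rule extended_cherry_imp_induced_forbidden_graph)
  qed
  finally show ?thesis .
qed

subsection \<open>Connectedness\<close>

lemma connected_induce_insert:
  assumes "connected (G \<restriction> T)" "u \<in> T" "u \<rightarrow>\<^bsub>G\<^esub> v"
  shows "connected (G \<restriction> insert v T)"
proof -
  define R where "R = (\<lambda>S. symcl (arcs_ends (G \<restriction> S)))"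
  have connected_iff: "connected (G \<restriction> S) \<longleftrightarrow> S \<noteq> {} \<and> (\<forall>a\<in>S. \<forall>b\<in>S. (a, b) \<in> rtrancl_on S (R S))"
    for S by (simp add: connected_conv R_def)
  let ?T = "insert v T"
  have arc: "(u, v) \<in> R ?T"
    using assms(2,3) by (auto simp: R_def symcl_def arcs_ends_conv)
  have "R T \<subseteq> R ?T" by (auto simp: R_def symcl_def arcs_ends_conv)
  then have "(u, a) \<in> rtrancl_on ?T (R ?T)" if "a \<in> T" for a
    using assms(1,2) that unfolding connected_iff by (blast intro: rtrancl_on_mono)
  moreover from this[OF assms(2)] have "(u, v) \<in> rtrancl_on ?T (R ?T)"
    using arc by (rule rtrancl_on_into_rtrancl_on) simp
  ultimately have reach: "(u, a) \<in> rtrancl_on ?T (R ?T)" if "a \<in> ?T" for a using that by blast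
  have "sym (R ?T)" by (auto simp: R_def symcl_def intro!: symI)
  then have "(a, b) \<in> rtrancl_on ?T (R ?T)" if "a \<in> ?T" "b \<in> ?T" for a b
    using rtrancl_on_trans[OF symD[OF rtrancl_on_sym reach] reach] that by blast
  then show ?thesis by (simp add: connected_iff)
qed

lemma (in sym_digraph) connected_crossing_arcE:
  assumes "connected G" "a \<in> verts G \<inter> S" "b \<in> verts G - S"
  obtains u v where "u \<in> S" "v \<notin> S" "u \<rightarrow> v"
proof -
  have "a \<rightarrow>\<^sup>* b"
    using symmetric_connected_imp_strongly_connected[OF sym_arcs assms(1)] assms(2,3)
    by (auto simp: strongly_connected_def)
  moreover have "a \<in> S" "b \<notin> S" using assms(2,3) by simp_all
  ultimately have "\<exists>u v. u \<in> S \<and> v \<notin> S \<and> u \<rightarrow> v"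
  proof (induction rule: converse_reachable_induct)
    case (step x y)
    then show ?case by (cases "y \<in> S") blast+
  qed simp
  then show ?thesis using that by blast
qed

lemma (in sym_digraph) connected_induce_crossing_arcE:
  assumes "connected (G \<restriction> T)" "T \<subseteq> verts G" "a \<in> T \<inter> S" "b \<in> T - S"
  obtains u v where "u \<in> T \<inter> S" "v \<in> T - S" "u \<rightarrow> v"
proof -
  interpret T: sym_digraph "G \<restriction> T"
    using assms(2) by (intro induced_graph_imp_graph induced_induce)
  obtain u v where "u \<in> S" "v \<notin> S" "u \<rightarrow>\<^bsub>G \<restriction> T\<^esub> v"
    using T.connected_crossing_arcE[of a S b] assms by auto
  moreover from this have "u \<in> T" "v \<in> T" "u \<rightarrow> v"
    using T.adj_in_verts dominates_induce_subgraphD by auto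
  ultimately show ?thesis using that by blast
qed

subsection \<open>Prefixes of search and BFS orderings\<close>

inductive search_prefix :: "'a pair_pre_digraph \<Rightarrow> 'a list \<Rightarrow> bool" for G where
  singleton: "v \<in> pverts G \<Longrightarrow> search_prefix G [v]"
| snoc: "search_prefix G \<tau> \<Longrightarrow> u \<in> set \<tau> \<Longrightarrow> (u, v) \<in> parcs G \<Longrightarrow> v \<notin> set \<tau> \<Longrightarrow>
    search_prefix G (\<tau> @ [v])"

inductive bfs_prefix :: "'a pair_pre_digraph \<Rightarrow> 'a list \<Rightarrow> bool" for G where
  singleton: "v \<in> pverts G \<Longrightarrow> bfs_prefix G [v]"
| snoc: "bfs_prefix G \<tau> \<Longrightarrow> \<tau> = xs @ u # ys \<Longrightarrow> parcs G `` set xs \<subseteq> set \<tau> \<Longrightarrow>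
    (u, v) \<in> parcs G \<Longrightarrow> v \<notin> set \<tau> \<Longrightarrow> bfs_prefix G (\<tau> @ [v])"

lemma bfs_prefix_imp_search_prefix: "bfs_prefix G \<tau> \<Longrightarrow> search_prefix G \<tau>"
proof (induction rule: bfs_prefix.induct)
  case (snoc \<tau> xs u ys v)
  then show ?case by (intro search_prefix.snoc[of G \<tau> u v]) simp_all
qed (rule search_prefix.singleton)

lemma search_prefix_not_Nil: "search_prefix G \<tau> \<Longrightarrow> \<tau> \<noteq> []"
  by (induction rule: search_prefix.induct) auto

lemma (in pair_wf_digraph) search_prefix_distinct_subset:
  assumes "search_prefix G \<tau>"
  shows "distinct \<tau> \<and> set \<tau> \<subseteq> pverts G"
  using assms wellformed' by (induction rule: search_prefix.induct) auto

lemma search_prefix_connected_take: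
  assumes "search_prefix G \<tau>" "1 \<le> k" "k \<le> length \<tau>"
  shows "connected (with_proj G \<restriction> set (take k \<tau>))"
  using assms
proof (induction arbitrary: k rule: search_prefix.induct)
  case (singleton v)
  then show ?case by (simp add: connected_conv)
next
  case (snoc \<tau> u v)
  then consider (prefix) "k \<le> length \<tau>" | (whole) "k = Suc (length \<tau>)" by fastforce
  then show ?case
  proof cases
    case prefix
    then show ?thesis using snoc by simp
  next
    case whole
    have "connected (with_proj G \<restriction> set \<tau>)"
      using snoc.IH[of "length \<tau>"] search_prefix_not_Nil[OF snoc.hyps(1)]
      by (simp add: Suc_le_eq)
    then show ?thesis
      using connected_induce_insert[of "with_proj G" "set \<tau>" u v] snoc.hyps whole by simp
  qed
qed

lemma (in pair_wf_digraph) search_prefix_imp_search_ordering: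
  assumes "search_prefix G \<sigma>" "set \<sigma> = pverts G"
  shows "search_ordering G \<sigma>"
  using assms search_prefix_distinct_subset search_prefix_connected_take[OF assms(1)]
  by (simp add: search_ordering_def vertex_ordering_def)

text \<open>
  A vertex \<open>c\<close> outside \<open>\<tau>\<close> counts as later than \<open>b\<close>: every extension of \<open>\<tau>\<close> lists it there.
\<close>

lemma bfs_prefix_earlier_neighbour:
  assumes "bfs_prefix G \<tau>" "precedes \<tau> a b" "(a, c) \<in> parcs G" "(a, b) \<notin> parcs G"
    and "c \<notin> set \<tau> \<or> precedes \<tau> b c"
  shows "\<exists>d. precedes \<tau> d a \<and> (d, b) \<in> parcs G"
  using assms
proof (induction rule: bfs_prefix.induct)
  case (snoc \<tau> xs u ys v)
  from snoc.prems(1) consider (old) "precedes \<tau> a b" | (new) "a \<in> set \<tau>" "b = v" by auto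
  then show ?case
  proof cases
    case old
    then have "c \<notin> set \<tau> \<or> precedes \<tau> b c" using snoc.prems(4) snoc.hyps(5) by auto
    then show ?thesis using snoc.IH[OF old] snoc.prems by auto
  next
    case new
    have "c \<notin> set \<tau>"
      using snoc.prems(4) \<open>v \<notin> set \<tau>\<close> \<open>b = v\<close> by (auto dest: precedes_in_set)
    then have "a \<notin> set xs" using snoc.hyps(3) snoc.prems(2) by blast
    moreover have "a \<noteq> u" using snoc.hyps(4) snoc.prems(3) new by blast
    ultimately have "a \<in> set ys" using snoc.hyps(2) new by simp
    then show ?thesis using snoc.hyps new by auto
  qed
qed simp

lemma (in pair_wf_digraph) bfs_prefix_imp_bfs_ordering:
  assumes "bfs_prefix G \<sigma>" "set \<sigma> = pverts G"
  shows "bfs_ordering G \<sigma>"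
  using assms search_prefix_distinct_subset[OF bfs_prefix_imp_search_prefix[OF assms(1)]]
    bfs_prefix_earlier_neighbour[OF assms(1)]
  unfolding bfs_ordering_def vertex_ordering_def by blast

lemma extend_to_enumeration:
  assumes "finite V" "P \<tau>"
    and "\<And>\<tau>. P \<tau> \<Longrightarrow> distinct \<tau> \<and> set \<tau> \<subseteq> V"
    and "\<And>\<tau>. P \<tau> \<Longrightarrow> set \<tau> \<noteq> V \<Longrightarrow> \<exists>v. P (\<tau> @ [v])"
  shows "\<exists>\<rho>. P (\<tau> @ \<rho>) \<and> set (\<tau> @ \<rho>) = V"
  using assms(2)
proof (induction "card (V - set \<tau>)" arbitrary: \<tau> rule: less_induct)
  case less
  show ?case
  proof (cases "set \<tau> = V")
    case True
    with less.prems show ?thesis by (intro exI[of _ "[]"]) simp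
  next
    case False
    with less.prems obtain v where v: "P (\<tau> @ [v])" using assms(4) by blast
    then have "v \<in> V - set \<tau>" using assms(3)[OF v] by auto
    then have "card (V - set (\<tau> @ [v])) < card (V - set \<tau>)"
      using assms(1) by (intro psubset_card_mono) auto
    from less.hyps[OF this v] obtain \<rho>
      where "P ((\<tau> @ [v]) @ \<rho>)" "set ((\<tau> @ [v]) @ \<rho>) = V" by blast
    then show ?thesis by (intro exI[of _ "v # \<rho>"]) simp
  qed
qed

lemma (in pair_sym_digraph) search_prefix_leaving_arcE:
  assumes "connected (with_proj G)" "search_prefix G \<tau>" "set \<tau> \<noteq> pverts G"
  obtains u v where "u \<in> set \<tau>" "v \<notin> set \<tau>" "(u, v) \<in> parcs G"
proof -
  have subset: "set \<tau> \<subseteq> pverts G" using search_prefix_distinct_subset[OF assms(2)] by simp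
  then obtain b where "b \<in> pverts G - set \<tau>" using assms(3) by blast
  moreover have "hd \<tau> \<in> pverts G \<inter> set \<tau>"
    using search_prefix_not_Nil[OF assms(2)] subset by auto
  ultimately show ?thesis using connected_crossing_arcE[OF assms(1)] that by blast
qed

lemma (in pair_pseudo_graph) search_prefix_extend:
  assumes "connected (with_proj G)" "search_prefix G \<tau>"
  shows "\<exists>\<rho>. search_ordering G (\<tau> @ \<rho>)"
proof -
  have "\<exists>\<rho>. search_prefix G (\<tau> @ \<rho>) \<and> set (\<tau> @ \<rho>) = pverts G"
  proof (rule extend_to_enumeration[where P = "search_prefix G", OF pair_finite_verts assms(2)])
    fix \<tau> assume "search_prefix G \<tau>" "set \<tau> \<noteq> pverts G"
    then show "\<exists>v. search_prefix G (\<tau> @ [v])"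
      using search_prefix_leaving_arcE[OF assms(1)] by (metis search_prefix.snoc)
  qed (rule search_prefix_distinct_subset)
  then show ?thesis using search_prefix_imp_search_ordering by blast
qed

lemma (in pair_pseudo_graph) bfs_prefix_extend:
  assumes "connected (with_proj G)" "bfs_prefix G \<tau>"
  shows "\<exists>\<rho>. bfs_ordering G (\<tau> @ \<rho>)"
proof -
  have "\<exists>\<rho>. bfs_prefix G (\<tau> @ \<rho>) \<and> set (\<tau> @ \<rho>) = pverts G"
  proof (rule extend_to_enumeration[where P = "bfs_prefix G", OF pair_finite_verts assms(2)])
    fix \<tau> assume \<tau>: "bfs_prefix G \<tau>" and "set \<tau> \<noteq> pverts G"
    then have "\<exists>u\<in>set \<tau>. \<not> parcs G `` {u} \<subseteq> set \<tau>"
      using search_prefix_leaving_arcE[OF assms(1) bfs_prefix_imp_search_prefix[OF \<tau>]] by blast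
    from split_list_first_prop[OF this] obtain xs u ys
      where "\<tau> = xs @ u # ys" "\<not> parcs G `` {u} \<subseteq> set \<tau>" "parcs G `` set xs \<subseteq> set \<tau>" by blast
    then show "\<exists>v. bfs_prefix G (\<tau> @ [v])" using bfs_prefix.snoc[OF \<tau>] by blast
  qed (rule search_prefix_distinct_subset[OF bfs_prefix_imp_search_prefix])
  then show ?thesis using bfs_prefix_imp_bfs_ordering by blast
qed

subsection \<open>Vertices skipped by an edge\<close>

definition skipping_triple :: "'a pair_pre_digraph \<Rightarrow> 'a list \<Rightarrow> 'a \<Rightarrow> 'a \<Rightarrow> 'a \<Rightarrow> bool" where
  "skipping_triple G \<sigma> a b c \<longleftrightarrow>
     precedes \<sigma> a b \<and> precedes \<sigma> b c \<and> (a, c) \<in> parcs G \<and> (a, b) \<notin> parcs G"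

lemma bfs_ordering_iff:
  "bfs_ordering G \<sigma> \<longleftrightarrow> vertex_ordering G \<sigma> \<and>
    (\<forall>a b c. skipping_triple G \<sigma> a b c \<longrightarrow> (\<exists>d. precedes \<sigma> d a \<and> (d, b) \<in> parcs G))"
  by (simp add: bfs_ordering_def skipping_triple_def)

lemma dfs_ordering_iff:
  "dfs_ordering G \<sigma> \<longleftrightarrow> vertex_ordering G \<sigma> \<and>
    (\<forall>a b c. skipping_triple G \<sigma> a b c \<longrightarrow>
      (\<exists>d. precedes \<sigma> a d \<and> precedes \<sigma> d b \<and> (d, b) \<in> parcs G))"
  by (simp add: dfs_ordering_def skipping_triple_def)

text \<open>The last hypothesis is the common weakening of the BFS and the DFS condition.\<close>

lemma (in pair_sym_digraph) search_orderingI_earlier_neighbour: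
  assumes "connected (with_proj G)" "vertex_ordering G \<sigma>"
    and earlier: "\<And>a b c. skipping_triple G \<sigma> a b c \<Longrightarrow> \<exists>d. precedes \<sigma> d b \<and> (d, b) \<in> parcs G"
  shows "search_ordering G \<sigma>"
proof -
  have distinct: "distinct \<sigma>" and verts: "set \<sigma> = pverts G"
    using assms(2) by (auto simp: vertex_ordering_def)
  have "search_prefix G \<tau>" if "\<tau> \<noteq> []" "\<sigma> = \<tau> @ \<rho>" for \<tau> \<rho>
    using that
  proof (induction \<tau> arbitrary: \<rho> rule: rev_nonempty_induct)
    case (single v)
    then show ?case using verts by (auto intro: search_prefix.singleton)
  next
    case (snoc v \<tau>)
    then have \<sigma>: "\<sigma> = \<tau> @ v # \<rho>" and \<tau>: "search_prefix G \<tau>" by simp_all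
    note precedes_v = precedes_append_Cons_iff[OF distinct[unfolded \<sigma>], folded \<sigma>]
    have "v \<notin> set \<tau>" using distinct \<sigma> by simp
    moreover have "v \<in> pverts G" using verts \<sigma> by auto
    ultimately obtain a c where ac: "a \<in> set \<tau>" "c \<notin> set \<tau>" "(a, c) \<in> parcs G"
      using search_prefix_leaving_arcE[OF assms(1) \<tau>] by blast
    have "\<exists>d\<in>set \<tau>. (d, v) \<in> parcs G"
    proof (cases "(a, v) \<in> parcs G")
      case False
      then have "c \<in> set \<rho>" using ac wellformed'(2)[OF ac(3)] verts \<sigma> by auto
      then have "skipping_triple G \<sigma> a v c"
        using False ac by (simp add: skipping_triple_def precedes_v)
      from earlier[OF this] show ?thesis by (auto simp: precedes_v)
    qed (use ac in blast)
    then show ?case using \<tau> \<open>v \<notin> set \<tau>\<close> by (blast intro: search_prefix.snoc)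
  qed
  moreover have "\<sigma> \<noteq> []" using assms(1) verts by (auto simp: connected_conv)
  ultimately show ?thesis using verts by (intro search_prefix_imp_search_ordering) simp_all
qed

lemma (in pair_sym_digraph) bfs_ordering_imp_search_ordering:
  assumes "connected (with_proj G)" "bfs_ordering G \<sigma>"
  shows "search_ordering G \<sigma>"
proof (rule search_orderingI_earlier_neighbour[OF assms(1)])
  show \<sigma>: "vertex_ordering G \<sigma>" using assms(2) by (simp add: bfs_ordering_iff)
  fix a b c assume skip: "skipping_triple G \<sigma> a b c"
  then obtain d where d: "precedes \<sigma> d a" "(d, b) \<in> parcs G"
    using assms(2) by (auto simp: bfs_ordering_iff)
  moreover have "precedes \<sigma> d b"
    using \<sigma> d(1) skip by (auto simp: vertex_ordering_def skipping_triple_def intro: precedes_trans)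
  ultimately show "\<exists>d. precedes \<sigma> d b \<and> (d, b) \<in> parcs G" by blast
qed

lemma (in pair_sym_digraph) dfs_ordering_imp_search_ordering:
  assumes "connected (with_proj G)" "dfs_ordering G \<sigma>"
  shows "search_ordering G \<sigma>"
  using assms(2) unfolding dfs_ordering_iff
  by (intro search_orderingI_earlier_neighbour[OF assms(1)]) blast+

lemma (in pair_sym_digraph) skipping_triple_imp_extended_cherry:
  assumes "search_ordering G \<sigma>" "skipping_triple G \<sigma> a b c"
  shows "\<exists>u y. extended_cherry G u a y c"
proof -
  have distinct: "distinct \<sigma>" and verts: "set \<sigma> = pverts G"
    and skip: "precedes \<sigma> a b" "precedes \<sigma> b c" "(a, c) \<in> parcs G" "(a, b) \<notin> parcs G"
    using assms by (auto simp: search_ordering_def vertex_ordering_def skipping_triple_def)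
  obtain xs ys where \<sigma>: "\<sigma> = xs @ b # ys"
    using precedes_in_set(2)[OF skip(1)] by (auto dest: split_list)
  define T where "T = insert b (set xs)"
  have "a \<in> set xs" "c \<in> set ys"
    using skip(1,2) unfolding \<sigma> precedes_append_Cons_iff[OF distinct[unfolded \<sigma>]] by simp_all
  then have T: "a \<in> T" "b \<in> T" "a \<noteq> b" "c \<notin> T" "T \<subseteq> pverts G"
    using distinct verts by (auto simp: \<sigma> T_def)
  have "take (Suc (length xs)) \<sigma> = xs @ [b]" "Suc (length xs) \<le> length \<sigma>" by (simp_all add: \<sigma>)
  moreover from this have "connected (with_proj G \<restriction> set (take (Suc (length xs)) \<sigma>))"
    using assms(1) by (auto simp: search_ordering_def)
  ultimately have connected_T: "connected (with_proj G \<restriction> T)" by (simp add: T_def)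
  define N where "N = insert a (parcs G `` {a})"
  have "a \<in> T \<inter> N" "b \<in> T - N" using T skip(4) by (simp_all add: N_def)
  then obtain u y where uy: "u \<in> T \<inter> N" "y \<in> T - N" "(u, y) \<in> parcs G"
    by (rule connected_induce_crossing_arcE[OF connected_T T(5)])
  then have "(u, a) \<in> parcs G" using arcs_symmetric by (auto simp: N_def)
  then have "extended_cherry G u a y c"
    using uy T skip(3) by (auto simp: extended_cherry_def N_def)
  then show ?thesis by blast
qed

lemma (in pair_sym_digraph) search_ordering_imp_bfs_dfs_ordering:
  assumes "\<nexists>u x y z. extended_cherry G u x y z" "search_ordering G \<sigma>"
  shows "bfs_ordering G \<sigma> \<and> dfs_ordering G \<sigma>"
proof -
  have "\<not> skipping_triple G \<sigma> a b c" for a b c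
    using skipping_triple_imp_extended_cherry[OF assms(2)] assms(1) by blast
  then show ?thesis
    using assms(2) by (simp add: bfs_ordering_iff dfs_ordering_iff search_ordering_def)
qed

subsection \<open>Orderings that start with the pattern\<close>

lemma (in pair_pseudo_graph) extended_cherry_imp_bfs_not_dfs:
  assumes "connected (with_proj G)" "extended_cherry G u x y z"
  shows "\<exists>\<sigma>. bfs_ordering G \<sigma> \<and> \<not> dfs_ordering G \<sigma>"
proof -
  have verts: "{u, x, y, z} \<subseteq> pverts G" using assms(2) by (rule extended_cherry_in_verts)
  then have "bfs_prefix G [u]" by (simp add: bfs_prefix.singleton)
  then have "bfs_prefix G [u, x]"
    using bfs_prefix.snoc[of G "[u]" "[]" u "[]" x] assms(2) by (auto simp: extended_cherry_def)
  then have "bfs_prefix G [u, x, y]"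
    using bfs_prefix.snoc[of G "[u, x]" "[]" u "[x]" y] assms(2)
    by (auto simp: extended_cherry_def)
  then obtain \<rho> where bfs: "bfs_ordering G ([u, x, y] @ \<rho>)"
    using bfs_prefix_extend[OF assms(1)] by blast
  then have distinct: "distinct ([u, x, y] @ \<rho>)" and "z \<in> set ([u, x, y] @ \<rho>)"
    using verts by (auto simp: bfs_ordering_def vertex_ordering_def)
  then have "skipping_triple G ([u, x, y] @ \<rho>) x y z"
    using assms(2) by (auto simp: skipping_triple_def extended_cherry_def)
  moreover have "\<not> (precedes ([u, x, y] @ \<rho>) x d \<and> precedes ([u, x, y] @ \<rho>) d y)" for d
    using distinct by (auto dest: precedes_in_set)
  ultimately have "\<not> dfs_ordering G ([u, x, y] @ \<rho>)" unfolding dfs_ordering_iff by blast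
  with bfs show ?thesis by blast
qed

lemma (in pair_pseudo_graph) extended_cherry_imp_search_not_bfs:
  assumes "connected (with_proj G)" "extended_cherry G u x y z"
  shows "\<exists>\<sigma>. search_ordering G \<sigma> \<and> \<not> bfs_ordering G \<sigma>"
proof -
  have verts: "{u, x, y, z} \<subseteq> pverts G" using assms(2) by (rule extended_cherry_in_verts)
  then have "search_prefix G [x]" by (simp add: search_prefix.singleton)
  then have "search_prefix G [x, u]"
    using search_prefix.snoc[of G "[x]" x u] assms(2) arcs_symmetric
    by (auto simp: extended_cherry_def)
  then have "search_prefix G [x, u, y]"
    using search_prefix.snoc[of G "[x, u]" u y] assms(2) by (auto simp: extended_cherry_def)
  then obtain \<rho> where search: "search_ordering G ([x, u, y] @ \<rho>)"
    using search_prefix_extend[OF assms(1)] by blast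
  then have distinct: "distinct ([x, u, y] @ \<rho>)" and "z \<in> set ([x, u, y] @ \<rho>)"
    using verts by (auto simp: search_ordering_def vertex_ordering_def)
  then have "skipping_triple G ([x, u, y] @ \<rho>) x y z"
    using assms(2) by (auto simp: skipping_triple_def extended_cherry_def)
  moreover have "\<not> precedes ([x, u, y] @ \<rho>) d x" for d
    using distinct by (auto dest: precedes_in_set)
  ultimately have "\<not> bfs_ordering G ([x, u, y] @ \<rho>)" unfolding bfs_ordering_iff by blast
  with search show ?thesis by blast
qed

theorem theorem1:
  fixes G :: "'a pair_pre_digraph"
  assumes "pair_graph G" and "Digraph_Component.connected (with_proj G)"
  defines "A1 \<equiv> free_of {P4_graph, C4_graph, paw_graph, diamond_graph} G"
      and "A2 \<equiv> \<forall>\<sigma>. search_ordering G \<sigma> \<longrightarrow> dfs_ordering G \<sigma>"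
      and "A3 \<equiv> \<forall>\<sigma>. search_ordering G \<sigma> \<longrightarrow> bfs_ordering G \<sigma>"
      and "A4 \<equiv> \<forall>\<sigma>. vertex_ordering G \<sigma> \<longrightarrow> (bfs_ordering G \<sigma> \<longleftrightarrow> dfs_ordering G \<sigma>)"
  shows "(A1 \<longleftrightarrow> A2) \<and> (A2 \<longleftrightarrow> A3) \<and> (A3 \<longleftrightarrow> A4)"
proof -
  interpret pair_graph G by fact
  note bfs_imp_search = bfs_ordering_imp_search_ordering[OF assms(2)]
    and dfs_imp_search = dfs_ordering_imp_search_ordering[OF assms(2)]
  have A1_iff: "A1 \<longleftrightarrow> (\<nexists>u x y z. extended_cherry G u x y z)"
    unfolding A1_def by (rule free_of_forbidden_graphs_iff)
  show ?thesis
  proof (cases A1)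
    case True
    then have "bfs_ordering G \<sigma> \<and> dfs_ordering G \<sigma>" if "search_ordering G \<sigma>" for \<sigma>
      using that A1_iff by (intro search_ordering_imp_bfs_dfs_ordering) simp_all
    then show ?thesis
      using True bfs_imp_search dfs_imp_search unfolding A2_def A3_def A4_def by blast
  next
    case False
    then obtain u x y z where cherry: "extended_cherry G u x y z" using A1_iff by blast
    then have "\<not> A2" "\<not> A4"
      using extended_cherry_imp_bfs_not_dfs[OF assms(2) cherry] bfs_imp_search
      by (auto simp: A2_def A4_def bfs_ordering_def)
    moreover have "\<not> A3"
      using extended_cherry_imp_search_not_bfs[OF assms(2) cherry] by (auto simp: A3_def)
    ultimately show ?thesis using False by blast
  qed
qed

end
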